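(* Let $1<p<\infty$, let $a=\{a_n\}_{n\ge 0}$ be a sequence of complex numbers, and let $T_a:L^p[0,1]\to L^p[0,1]$ be a bounded Walsh multiplier with symbol $a$. Then $$\overline{\{a_n:\ n\ge 0\}}\subset\sigma(T_a).$$
   Context: All function spaces consist of complex-valued functions on $[0,1]$ with Lebesgue measure. For $k\in\mathbb{N}_0=\{0,1,2,\dots\}$ the Rademacher functions are $r_k(x)=\operatorname{sign}(\sin(2^{k+1}\pi x))$, $x\in[0,1)$. If $n=\sum_{k=0}^m b_k2^k$ with $b_k\in\{0,1\}$ is the dyadic expansion of $n\in\mathbb{N}_0$, the Walsh(-Paley) function is $W_n(x)=\prod_{k=0}^m r_k(x)^{b_k}$ (with $W_0=1$). The Walsh functions take values $\pm1$ a.e. and form an orthonormal system in $L^2[0,1]$. For $f\in L^1[0,1]$ the Walsh-Fourier coefficients are $\hat f(n)=\int_0^1 f(x)W_n(x)\,dx$, $n\in\mathbb{N}_0$. For $1<p<\infty$ the Walsh system (in the order $n=0,1,2,\dots$) is a Schauder basis of $L^p[0,1]$, so $f=\sum_{n\ge0}\hat f(n)W_n$ in $L^p$ norm. The Walsh multiplier operator with symbol $a=\{a_n\}_{n\ge0}$ is given by $T_af=\sum_{n=0}^\infty a_n\hat f(n)W_n$. That $T_a:L^p[0,1]\to L^p[0,1]$ is a bounded Walsh multiplier means that this formula defines a bounded linear operator from $L^p[0,1]$ to $L^p[0,1]$ (equivalently, $T_a$ is the bounded linear operator on $L^p[0,1]$ with $T_aW_n=a_nW_n$ for all $n$). $\sigma(T_a)$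 denotes the spectrum of $T_a$ as a bounded operator on $L^p[0,1]$, and the bar denotes closure in $\mathbb{C}$. *)

theory Defs
  imports "HOL-Analysis.Analysis"
begin

abbreviation unit_leb :: "real measure"
  where "unit_leb \<equiv> lebesgue_on {0..1}"

definition rademacher :: "nat \<Rightarrow> real \<Rightarrow> real"
  where "rademacher k x = sgn (sin (2 ^ (k + 1) * pi * x))"

(* The exponent is the k-th binary digit of n. As n < 2 ^ n, all nonzero digits have index k \<le> n. *)
definition walsh :: "nat \<Rightarrow> real \<Rightarrow> complex"
  where "walsh n x = of_real (\<Prod>k\<le>n. rademacher k x ^ (n div 2 ^ k mod 2))"

definition walsh_coeff :: "(real \<Rightarrow> complex) \<Rightarrow> nat \<Rightarrow> complex"
  where "walsh_coeff f n = (LINT x|unit_leb. f x * walsh n x)"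

(* Elements of L^p[0,1] are handled through representatives, i.e. total functions of which only the
   values on [0,1] matter; equality in L^p[0,1] is the relation ae_eq. *)

definition ae_eq :: "(real \<Rightarrow> complex) \<Rightarrow> (real \<Rightarrow> complex) \<Rightarrow> bool"
  where "ae_eq f g \<longleftrightarrow> (AE x in unit_leb. f x = g x)"

definition Lp :: "real \<Rightarrow> (real \<Rightarrow> complex) set"
  where "Lp p = {f. f \<in> borel_measurable unit_leb \<and> integrable unit_leb (\<lambda>x. norm (f x) powr p)}"

definition Lp_norm :: "real \<Rightarrow> (real \<Rightarrow> complex) \<Rightarrow> real"
  where "Lp_norm p f = (LINT x|unit_leb. norm (f x) powr p) powr (1 / p)"

(* The second conjunct makes T a well-defined map on classes modulo ae_eq. *)
definition bounded_op_Lp :: "real \<Rightarrow> ((real \<Rightarrow> complex) \<Rightarrow> (real \<Rightarrow> complex)) \<Rightarrow> bool"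
  where "bounded_op_Lp p T \<longleftrightarrow>
    (\<forall>f\<in>Lp p. T f \<in> Lp p) \<and>
    (\<forall>f\<in>Lp p. \<forall>g\<in>Lp p. ae_eq f g \<longrightarrow> ae_eq (T f) (T g)) \<and>
    (\<forall>f\<in>Lp p. \<forall>g\<in>Lp p. ae_eq (T (\<lambda>x. f x + g x)) (\<lambda>x. T f x + T g x)) \<and>
    (\<forall>c. \<forall>f\<in>Lp p. ae_eq (T (\<lambda>x. c * f x)) (\<lambda>x. c * T f x)) \<and>
    (\<exists>C. \<forall>f\<in>Lp p. Lp_norm p (T f) \<le> C * Lp_norm p f)"

(* l is in the spectrum iff l I - T has no two-sided inverse S among the bounded operators. *)
definition spectrum_Lp :: "real \<Rightarrow> ((real \<Rightarrow> complex) \<Rightarrow> (real \<Rightarrow> complex)) \<Rightarrow> complex set"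
  where "spectrum_Lp p T = {l. \<not> (\<exists>S. bounded_op_Lp p S \<and>
    (\<forall>f\<in>Lp p. ae_eq (S (\<lambda>x. l * f x - T f x)) f \<and>
                ae_eq (\<lambda>x. l * S f x - T (S f) x) f))}"

(* T is bounded on L^p[0,1] and T f is the sum, in L^p norm, of the series of a n * walsh_coeff f n * walsh n. *)
definition bounded_walsh_multiplier ::
    "real \<Rightarrow> (nat \<Rightarrow> complex) \<Rightarrow> ((real \<Rightarrow> complex) \<Rightarrow> (real \<Rightarrow> complex)) \<Rightarrow> bool"
  where "bounded_walsh_multiplier p a T \<longleftrightarrow>
    bounded_op_Lp p T \<and>
    (\<forall>f\<in>Lp p. (\<lambda>N. Lp_norm p (\<lambda>x. T f x - (\<Sum>n<N. a n * walsh_coeff f n * walsh n x)))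
                 \<longlonglongrightarrow> 0)"

end

theory Submission
  imports Defs
begin

text \<open>
  Each \<open>a m\<close> is an eigenvalue of \<open>T\<close> with eigenvector \<open>walsh m\<close>: the Walsh functions are
  orthonormal, so the series defining \<open>T (walsh m)\<close> has the single term \<open>a m * walsh m\<close>
  (lemma \<open>walsh_eigenfunction\<close>). Walsh functions have modulus 1 almost everywhere, hence
  \<open>Lp\<close> norm 1. If \<open>l I - T\<close> had an inverse \<open>S\<close> of norm at most \<open>C\<close>, then applying \<open>S\<close> to
  \<open>(l I - T) (walsh m) = (l - a m) walsh m\<close> would give \<open>1 \<le> C * \<bar>l - a m\<bar>\<close> for every \<open>m\<close>,
  so \<open>l\<close> would keep a positive distance from all \<open>a m\<close> (lemma \<open>resolvent_bound\<close>). One estimate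
  thus covers the eigenvalues and their limit points alike.

  Orthogonality comes from a symmetry. Almost everywhere, the product of two different Walsh
  functions is a product of Rademacher functions over the nonempty set of digits in which the
  indices differ. If \<open>j\<close> is the smallest such digit, translation by \<open>1 / 2 ^ (j + 1)\<close> changes the
  sign of the \<open>j\<close>-th Rademacher function and preserves all later ones, so it negates the
  product. Since the product is also 1-periodic, its integral over a period vanishes.
\<close>

section \<open>Rademacher functions\<close>

lemma rademacher_measurable [measurable]: "rademacher k \<in> borel_measurable borel"
  unfolding rademacher_def by measurable

lemma abs_rademacher_le_1: "\<bar>rademacher k x\<bar> \<le> 1"
  by (simp add: rademacher_def abs_sgn_eq)

lemma rademacher_shift_flip: "rademacher k (x + 1 / 2 ^ (k + 1)) = - rademacher k x"
proof -
  have "2 ^ (k + 1) * pi * (x + 1 / 2 ^ (k + 1)) = 2 ^ (k + 1) * pi * x + pi"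
    by (simp add: field_simps)
  then show ?thesis
    by (simp only: rademacher_def sin_periodic_pi sgn_minus)
qed

lemma rademacher_shift_invariant:
  assumes "j < k"
  shows "rademacher k (x + 1 / 2 ^ (j + 1)) = rademacher k x"
proof -
  obtain d where k: "k = j + 1 + d"
    using less_imp_Suc_add[OF assms] by auto
  have "2 ^ (k + 1) * pi * (x + 1 / 2 ^ (j + 1)) = 2 ^ (k + 1) * pi * x + 2 * real (2 ^ d) * pi"
    unfolding k by (simp add: field_simps power_add)
  moreover have "sin (y + 2 * real n * pi) = sin y" for y n
    by (simp add: sin_add)
  ultimately show ?thesis
    by (simp only: rademacher_def)
qed

text \<open>
  Translation by 1 is translation by 1/2 done twice: each half flips the sign for \<open>k = 0\<close> and
  changes nothing for larger \<open>k\<close>.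
\<close>

lemma rademacher_periodic: "rademacher k (x + 1) = rademacher k x"
proof -
  have "rademacher k (x + 1 / 2 ^ 1 + 1 / 2 ^ 1) = rademacher k x"
  proof (cases k)
    case 0
    then show ?thesis
      using rademacher_shift_flip[of 0 x] rademacher_shift_flip[of 0 "x + 1 / 2"] by simp
  next
    case (Suc i)
    then show ?thesis
      using rademacher_shift_invariant[of 0 k x] rademacher_shift_invariant[of 0 k "x + 1 / 2"]
      by simp
  qed
  then show ?thesis
    by (simp add: add.assoc)
qed

text \<open>
  A Rademacher function vanishes only at dyadic rationals, a countable set that serves all \<open>k\<close>
  at once.
\<close>

lemma AE_rademacher_squared: "AE x in unit_leb. \<forall>k. (rademacher k x)\<^sup>2 = 1"
proof -
  let ?Z = "\<Union>k::nat. range (\<lambda>i::int. real_of_int i / 2 ^ (k + 1))"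
  have "?Z \<in> null_sets lborel"
    by (intro countable_imp_null_set_lborel countable_UN countable_image) auto
  then have "AE x in lebesgue. x \<notin> ?Z"
    by (intro AE_completion AE_not_in)
  then have "AE x in unit_leb. x \<notin> ?Z"
    by (subst AE_restrict_space_iff) (auto elim: eventually_mono)
  then show ?thesis
  proof (rule eventually_mono, intro allI)
    fix x :: real and k :: nat
    assume x: "x \<notin> ?Z"
    have "sin (2 ^ (k + 1) * pi * x) \<noteq> 0"
    proof
      assume "sin (2 ^ (k + 1) * pi * x) = 0"
      then obtain i :: int where "2 ^ (k + 1) * pi * x = of_int i * pi"
        by (auto simp: sin_zero_iff_int2)
      then have "x = of_int i / 2 ^ (k + 1)"
        by (simp add: field_simps)
      with x show False
        by blast
    qed
    then show "(rademacher k x)\<^sup>2 = 1"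
      by (simp add: rademacher_def sgn_if)
  qed
qed

text \<open>
  The integral over a period does not change under translation, and here translation by \<open>h\<close>
  changes its sign.
\<close>

lemma integral_antiperiodic_zero:
  fixes f :: "real \<Rightarrow> real"
  assumes int: "\<And>a b. f integrable_on {a..b}"
    and period: "\<And>x. f (x + 1) = f x"
    and anti: "\<And>x. f (x + h) = - f x"
    and h: "0 \<le> h" "h \<le> 1"
  shows "integral {0..1} f = 0"
proof -
  have shift: "integral {a + c..b + c} f = integral {a..b} (\<lambda>x. f (x + c))" for a b c
    using integral_shift_Icc_real[of a b f c] by (simp add: o_def add.commute)
  have "integral {0..1} f = integral {0..h} f + integral {h..1} f"
    using h int by (intro Henstock_Kurzweil_Integration.integral_combine [symmetric]) auto
  also have "integral {0..h} f = integral {1..1 + h} f"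
    using shift[of 0 1 h] period by (simp add: add.commute)
  also have "integral {1..1 + h} f + integral {h..1} f = integral {h..1 + h} f"
    using Henstock_Kurzweil_Integration.integral_combine[of h 1 "1 + h" f] h int by simp
  also have "\<dots> = - integral {0..1} f"
    using shift[of 0 h 1] anti by simp
  finally show ?thesis
    by simp
qed

text \<open>
  The smallest index \<open>j\<close> in \<open>A\<close> gives the translation length \<open>1 / 2 ^ (j + 1)\<close>: it flips the
  factor \<open>j\<close> and is a period of every other factor, hence it negates the product.
\<close>

lemma integral_rademacher_prod:
  assumes "finite A" "A \<noteq> {}"
  shows "(LINT x|unit_leb. (\<Prod>k\<in>A. rademacher k x)) = 0"
proof -
  let ?P = "\<lambda>x. \<Prod>k\<in>A. rademacher k x"
  define j where "j = Min A"
  have j: "j \<in> A" "\<And>k. k \<in> A \<Longrightarrow> j \<le> k"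
    using assms by (auto simp: j_def)
  have int: "integrable (lebesgue_on {a..b}) ?P" for a b :: real
  proof (rule integrableI_bounded_set[where A = "{a..b}" and B = 1])
    show "?P \<in> borel_measurable (lebesgue_on {a..b})"
      by (intro measurable_restrict_space1 measurable_completion) measurable
    have "\<bar>?P x\<bar> \<le> 1" for x
      by (simp add: abs_prod prod_le_1 abs_rademacher_le_1)
    then show "AE x in lebesgue_on {a..b}. x \<in> {a..b} \<longrightarrow> norm (?P x) \<le> 1"
      by simp
  qed (auto simp: emeasure_restrict_space sets_restrict_space emeasure_lborel_Icc_eq)
  have "integral {0..1} ?P = 0"
  proof (rule integral_antiperiodic_zero[where h = "1 / 2 ^ (j + 1)"])
    show "?P integrable_on {a..b}" for a b
      using integrable_on_lebesgue_on[OF int] by simp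
    show "?P (x + 1) = ?P x" for x
      by (simp add: rademacher_periodic)
    show "?P (x + 1 / 2 ^ (j + 1)) = - ?P x" for x
    proof -
      have "(\<Prod>k\<in>A - {j}. rademacher k (x + 1 / 2 ^ (j + 1))) = (\<Prod>k\<in>A - {j}. rademacher k x)"
        using j(2) by (intro prod.cong refl rademacher_shift_invariant) force
      then show ?thesis
        using rademacher_shift_flip[of j x] by (simp add: prod.remove[OF assms(1) j(1)])
    qed
    show "1 / 2 ^ (j + 1) \<le> (1 :: real)"
      using one_le_power[of "2 :: real" "j + 1"] by (simp add: field_simps)
  qed simp
  then show ?thesis
    by (subst lebesgue_integral_eq_integral) (use int in auto)
qed


section \<open>Orthonormality of the Walsh system\<close>

lemma walsh_measurable [measurable]: "walsh n \<in> borel_measurable borel"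
  unfolding walsh_def by measurable

lemma walsh_measurable_unit_leb: "walsh n \<in> borel_measurable unit_leb"
  by (intro measurable_restrict_space1 measurable_completion) simp

text \<open>
  The digits of \<open>n\<close> beyond position \<open>n\<close> are zero, so two Walsh functions can be written as
  products over a common range and multiplied factor by factor.
\<close>

lemma walsh_extend:
  assumes "n < K"
  shows "walsh n x = of_real (\<Prod>k<K. rademacher k x ^ (n div 2 ^ k mod 2))"
proof -
  have "n div 2 ^ k = 0" if "n < k" for k
    using less_trans[OF that less_exp] by (rule div_less)
  then have "(\<Prod>k\<le>n. rademacher k x ^ (n div 2 ^ k mod 2)) =
      (\<Prod>k<K. rademacher k x ^ (n div 2 ^ k mod 2))"
    using assms by (intro prod.mono_neutral_left) (auto simp: not_le)
  then show ?thesis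
    by (simp add: walsh_def)
qed

text \<open>
  Where both indices have the digit 1 the factor is a square, which equals 1 off the dyadic
  rationals; only the digits in which the indices differ survive.
\<close>

lemma walsh_mult_AE:
  assumes "m < K" "n < K"
  shows "AE x in unit_leb. walsh m x * walsh n x =
    of_real (\<Prod>k\<in>{k. k < K \<and> m div 2 ^ k mod 2 \<noteq> n div 2 ^ k mod 2}. rademacher k x)"
  using AE_rademacher_squared
proof (rule eventually_mono)
  fix x assume sq: "\<forall>k. (rademacher k x)\<^sup>2 = 1"
  have "rademacher k x ^ (m div 2 ^ k mod 2) * rademacher k x ^ (n div 2 ^ k mod 2) =
      (if m div 2 ^ k mod 2 \<noteq> n div 2 ^ k mod 2 then rademacher k x else 1)" for k
    using sq by (cases "odd (m div 2 ^ k)"; cases "odd (n div 2 ^ k)")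
      (simp_all add: odd_iff_mod_2_eq_one even_iff_mod_2_eq_zero power2_eq_square)
  then have "(\<Prod>k<K. rademacher k x ^ (m div 2 ^ k mod 2)) *
      (\<Prod>k<K. rademacher k x ^ (n div 2 ^ k mod 2)) =
      (\<Prod>k<K. if m div 2 ^ k mod 2 \<noteq> n div 2 ^ k mod 2 then rademacher k x else 1)"
    by (simp add: prod.distrib [symmetric])
  also have "\<dots> = (\<Prod>k\<in>{k. k < K \<and> m div 2 ^ k mod 2 \<noteq> n div 2 ^ k mod 2}. rademacher k x)"
    by (subst prod.inter_filter [symmetric]) (auto simp: lessThan_def)
  finally show "walsh m x * walsh n x =
      of_real (\<Prod>k\<in>{k. k < K \<and> m div 2 ^ k mod 2 \<noteq> n div 2 ^ k mod 2}. rademacher k x)"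
    by (simp only: walsh_extend[OF assms(1)] walsh_extend[OF assms(2)] of_real_mult [symmetric])
qed

lemma norm_walsh_AE: "AE x in unit_leb. norm (walsh n x) = 1"
  using AE_rademacher_squared
proof (rule eventually_mono)
  fix x assume "\<forall>k. (rademacher k x)\<^sup>2 = 1"
  then have "\<bar>rademacher k x\<bar> = 1" for k
    by (metis abs_1 power2_eq_1_iff abs_minus_cancel)
  then show "norm (walsh n x) = 1"
    by (simp add: walsh_def abs_prod power_abs del: of_real_prod)
qed

lemma measure_unit_leb: "measure unit_leb (space unit_leb) = 1"
  by (simp add: measure_restrict_space)

lemma integrable_const_unit_leb: "integrable unit_leb (\<lambda>x. c :: real)"
  by (intro finite_measure.integrable_const finite_measureI) (simp add: emeasure_restrict_space)

lemma walsh_orthonormal: "walsh_coeff (walsh m) n = (if n = m then 1 else 0)"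
proof -
  define K where "K = Suc (max m n)"
  define A where "A = {k. k < K \<and> m div 2 ^ k mod 2 \<noteq> n div 2 ^ k mod 2}"
  have K: "m < K" "n < K"
    by (auto simp: K_def)
  have fin: "finite A"
    by (simp add: A_def)
  have "walsh_coeff (walsh m) n = (LINT x|unit_leb. complex_of_real (\<Prod>k\<in>A. rademacher k x))"
    unfolding walsh_coeff_def
  proof (rule integral_cong_AE)
    show "(\<lambda>x. walsh m x * walsh n x) \<in> borel_measurable unit_leb"
      by (intro borel_measurable_times walsh_measurable_unit_leb)
    show "(\<lambda>x. complex_of_real (\<Prod>k\<in>A. rademacher k x)) \<in> borel_measurable unit_leb"
      by (intro measurable_restrict_space1 measurable_completion) measurable
    show "AE x in unit_leb. walsh m x * walsh n x = of_real (\<Prod>k\<in>A. rademacher k x)"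
      using walsh_mult_AE[OF K] by (simp add: A_def)
  qed
  also have "\<dots> = of_real (LINT x|unit_leb. (\<Prod>k\<in>A. rademacher k x))"
    by (rule integral_complex_of_real)
  also have "\<dots> = (if n = m then 1 else 0)"
  proof (cases "n = m")
    case True
    then have "A = {}"
      by (simp add: A_def)
    then show ?thesis
      using True measure_unit_leb by simp
  next
    case False
    then obtain k where k: "bit m k \<noteq> bit n k"
      by (auto simp: bit_eq_iff)
    then have "m div 2 ^ k \<noteq> 0 \<or> n div 2 ^ k \<noteq> 0"
      by (auto simp: bit_iff_odd)
    then have "2 ^ k \<le> m \<or> 2 ^ k \<le> n"
      by (meson div_less not_le)
    then have "k < K"
      using less_exp[of k] unfolding K_def by linarith
    with k have "k \<in> A"
      by (auto simp: A_def bit_iff_odd odd_iff_mod_2_eq_one)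
    then show ?thesis
      using False integral_rademacher_prod[OF fin] by auto
  qed
  finally show ?thesis .
qed


section \<open>Walsh functions as unit vectors of Lp\<close>

lemma Lp_norm_cong:
  assumes "f \<in> borel_measurable unit_leb" "g \<in> borel_measurable unit_leb" "ae_eq f g"
  shows "Lp_norm p f = Lp_norm p g"
proof -
  have "(LINT x|unit_leb. norm (f x) powr p) = (LINT x|unit_leb. norm (g x) powr p)"
    using assms by (intro integral_cong_AE) (auto simp: ae_eq_def elim: eventually_mono)
  then show ?thesis
    by (simp add: Lp_norm_def)
qed

text \<open>
  The pointwise bound \<open>norm (u - v) \<le> 2 * max (norm u) (norm v)\<close> dominates the \<open>p\<close>-th power of
  the difference by \<open>2 powr p\<close> times the sum of the \<open>p\<close>-th powers.
\<close>

lemma Lp_diff: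
  assumes "0 < p" "f \<in> Lp p" "g \<in> Lp p"
  shows "(\<lambda>x. f x - g x) \<in> Lp p"
proof -
  have [measurable]: "f \<in> borel_measurable unit_leb" "g \<in> borel_measurable unit_leb"
    and int: "integrable unit_leb (\<lambda>x. norm (f x) powr p)"
      "integrable unit_leb (\<lambda>x. norm (g x) powr p)"
    using assms by (auto simp: Lp_def)
  have bound: "norm (u - v) powr p \<le> 2 powr p * (norm u powr p + norm v powr p)" for u v :: complex
  proof -
    have "norm (u - v) \<le> 2 * max (norm u) (norm v)"
      using norm_triangle_ineq4[of u v] by linarith
    then have "norm (u - v) powr p \<le> (2 * max (norm u) (norm v)) powr p"
      using assms(1) by (intro powr_mono2) auto
    also have "\<dots> = 2 powr p * max (norm u) (norm v) powr p"
      by (simp add: powr_mult le_max_iff_disj)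
    also have "max (norm u) (norm v) powr p \<le> norm u powr p + norm v powr p"
      by (simp add: max_def)
    finally show ?thesis
      by simp
  qed
  have "integrable unit_leb (\<lambda>x. norm (f x - g x) powr p)"
  proof (rule Bochner_Integration.integrable_bound)
    show "integrable unit_leb (\<lambda>x. 2 powr p * (norm (f x) powr p + norm (g x) powr p))"
      using int by simp
    show "AE x in unit_leb. norm (norm (f x - g x) powr p)
        \<le> norm (2 powr p * (norm (f x) powr p + norm (g x) powr p))"
      using bound by (simp add: abs_of_nonneg)
  qed measurable
  then show ?thesis
    by (simp add: Lp_def)
qed

lemma Lp_norm_zero_imp_AE:
  assumes "f \<in> Lp p" "Lp_norm p f = 0"
  shows "AE x in unit_leb. f x = 0"
proof -
  have "(LINT x|unit_leb. norm (f x) powr p) = 0"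
    using assms(2) by (simp add: Lp_norm_def)
  then have "AE x in unit_leb. norm (f x) powr p = 0"
    using assms(1) by (subst (asm) integral_nonneg_eq_0_iff_AE) (auto simp: Lp_def)
  then show ?thesis
    by simp
qed

lemma scaled_walsh_Lp: "(\<lambda>x. c * walsh n x) \<in> Lp p"
  and Lp_norm_scaled_walsh: "0 < p \<Longrightarrow> Lp_norm p (\<lambda>x. c * walsh n x) = norm c"
proof -
  have meas: "(\<lambda>x. c * walsh n x) \<in> borel_measurable unit_leb"
    by (intro borel_measurable_times walsh_measurable_unit_leb) simp
  then have meas_p: "(\<lambda>x. norm (c * walsh n x) powr p) \<in> borel_measurable unit_leb"
    by measurable
  have ae: "AE x in unit_leb. norm (c * walsh n x) powr p = norm c powr p"
    using norm_walsh_AE[of n] by (rule eventually_mono) (simp add: norm_mult)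
  have "integrable unit_leb (\<lambda>x. norm (c * walsh n x) powr p)"
    using ae by (intro integrable_cong_AE_imp[OF integrable_const_unit_leb meas_p])
      (auto elim: eventually_mono)
  with meas show "(\<lambda>x. c * walsh n x) \<in> Lp p"
    by (simp add: Lp_def)
  assume "0 < p"
  have "(LINT x|unit_leb. norm (c * walsh n x) powr p) = (LINT x|unit_leb. norm c powr p)"
    using ae meas_p by (intro integral_cong_AE) auto
  then show "Lp_norm p (\<lambda>x. c * walsh n x) = norm c"
    using \<open>0 < p\<close> measure_unit_leb by (simp add: Lp_norm_def powr_powr)
qed

lemmas walsh_Lp = scaled_walsh_Lp[of 1, simplified]
lemmas Lp_norm_walsh = Lp_norm_scaled_walsh[of _ 1, simplified]


section \<open>Eigenvalues and the resolvent bound\<close>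

text \<open>
  By orthonormality the partial sums of the series for \<open>T (walsh m)\<close> all equal
  \<open>a m * walsh m\<close> once they include the term \<open>m\<close>. The distance that tends to zero is therefore
  eventually constant, so it is zero.
\<close>

lemma walsh_eigenfunction:
  assumes "1 < p" "bounded_walsh_multiplier p a T"
  shows "ae_eq (T (walsh m)) (\<lambda>x. a m * walsh m x)"
proof -
  let ?d = "\<lambda>x. T (walsh m) x - a m * walsh m x"
  have "(\<Sum>n<N. a n * walsh_coeff (walsh m) n * walsh n x) = a m * walsh m x" if "m < N" for N x
    using that by (simp add: walsh_orthonormal if_distrib if_distribR sum.delta cong: if_cong)
  then have "\<forall>\<^sub>F N in sequentially. Lp_norm p (\<lambda>x. T (walsh m) x -
      (\<Sum>n<N. a n * walsh_coeff (walsh m) n * walsh n x)) = Lp_norm p ?d"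
    by (intro eventually_mono[OF eventually_gt_at_top[of m]]) simp
  moreover have "(\<lambda>N. Lp_norm p (\<lambda>x. T (walsh m) x -
      (\<Sum>n<N. a n * walsh_coeff (walsh m) n * walsh n x))) \<longlonglongrightarrow> 0"
    using assms(2) walsh_Lp by (auto simp: bounded_walsh_multiplier_def)
  ultimately have "(\<lambda>N::nat. Lp_norm p ?d) \<longlonglongrightarrow> 0"
    by (rule Lim_transform_eventually[rotated])
  then have "Lp_norm p ?d = 0"
    by (simp add: LIMSEQ_const_iff)
  moreover have "?d \<in> Lp p"
    using assms walsh_Lp
    by (intro Lp_diff scaled_walsh_Lp) (auto simp: bounded_walsh_multiplier_def bounded_op_Lp_def)
  ultimately have "AE x in unit_leb. ?d x = 0"
    by (intro Lp_norm_zero_imp_AE)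
  then show ?thesis
    by (simp add: ae_eq_def)
qed

text \<open>
  The constant is a bound of the resolvent at \<open>l\<close>, which maps \<open>(l - a m) * walsh m\<close>, of norm
  \<open>norm (l - a m)\<close>, to the unit vector \<open>walsh m\<close>.
\<close>

lemma resolvent_bound:
  assumes "1 < p" "bounded_walsh_multiplier p a T" "l \<notin> spectrum_Lp p T"
  obtains C where "\<And>m. 1 \<le> C * norm (l - a m)"
proof -
  obtain S where S: "bounded_op_Lp p S"
    and left_inv: "\<And>f. f \<in> Lp p \<Longrightarrow> ae_eq (S (\<lambda>x. l * f x - T f x)) f"
    using assms(3) by (auto simp: spectrum_Lp_def)
  from S obtain C where C: "\<And>f. f \<in> Lp p \<Longrightarrow> Lp_norm p (S f) \<le> C * Lp_norm p f"
    unfolding bounded_op_Lp_def by blast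
  have S_Lp: "S f \<in> Lp p" if "f \<in> Lp p" for f
    using S that by (auto simp: bounded_op_Lp_def)
  have "1 \<le> C * norm (l - a m)" for m
  proof -
    let ?f = "\<lambda>x. l * walsh m x - T (walsh m) x" and ?g = "\<lambda>x. (l - a m) * walsh m x"
    have f: "?f \<in> Lp p"
      using assms walsh_Lp
      by (intro Lp_diff scaled_walsh_Lp) (auto simp: bounded_walsh_multiplier_def bounded_op_Lp_def)
    have g: "?g \<in> Lp p"
      by (rule scaled_walsh_Lp)
    have "ae_eq ?f ?g"
      using walsh_eigenfunction[OF assms(1,2), of m] unfolding ae_eq_def
      by (rule eventually_mono) (simp add: algebra_simps)
    then have "ae_eq (S ?f) (S ?g)"
      using S f g by (auto simp: bounded_op_Lp_def)
    then have "ae_eq (walsh m) (S ?g)"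
      using left_inv[OF walsh_Lp, of m] unfolding ae_eq_def by eventually_elim simp
    then have "Lp_norm p (walsh m) = Lp_norm p (S ?g)"
      using S_Lp[OF g] walsh_measurable_unit_leb by (intro Lp_norm_cong) (auto simp: Lp_def)
    then show ?thesis
      using C[OF g] assms(1) by (simp add: Lp_norm_walsh Lp_norm_scaled_walsh)
  qed
  then show thesis
    by (rule that)
qed

theorem theorem4p3:
  fixes p :: real and a :: "nat \<Rightarrow> complex"
    and T :: "(real \<Rightarrow> complex) \<Rightarrow> (real \<Rightarrow> complex)"
  assumes "1 < p"
    and "bounded_walsh_multiplier p a T"
  shows "closure (range a) \<subseteq> spectrum_Lp p T"
proof (rule subsetI, rule ccontr)
  fix l assume l: "l \<in> closure (range a)" and "l \<notin> spectrum_Lp p T"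
  then obtain C where C: "\<And>m. 1 \<le> C * norm (l - a m)"
    using resolvent_bound[OF assms] by blast
  have "0 < C"
    using C[of 0] by (smt (verit) mult_nonpos_nonneg norm_ge_zero)
  moreover have "\<forall>e>0. \<exists>m. dist (a m) l < e"
    using l by (auto simp: closure_approachable)
  ultimately obtain m where "dist (a m) l < 1 / C"
    by (meson zero_less_divide_1_iff)
  then have "C * norm (l - a m) < 1"
    using \<open>0 < C\<close> by (simp add: dist_norm norm_minus_commute field_simps)
  with C[of m] show False
    by simp
qed

end
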